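(* Let $q$ be a prime power, let $\mathbb{F}_q$ be the field with $q$ elements, and let $n \geq 1$ be an integer. Let $E \subset \mathbb{F}_q^n$ be a set that is Kakeya with respect to hyperplanes, i.e. for every linear subspace $w \subset \mathbb{F}_q^n$ of dimension $n-1$ there is a vector $v \in \mathbb{F}_q^n$ such that $v + w \subset E$. Then \[ |E| \geq \frac{q^{2n} - q^n}{q^n + q^2 - 2q}. \]
   Context: A $k$-plane in $\mathbb{F}_q^n$ is a translate $w' = v + w$ (with $v \in \mathbb{F}_q^n$) of a $k$-dimensional linear subspace $w$ of $\mathbb{F}_q^n$; the subspace $w$ is uniquely determined by $w'$ and is called the direction of $w'$. A hyperplane is an $(n-1)$-plane. A set $E \subset \mathbb{F}_q^n$ is Kakeya with respect to $k$-planes if for every $k$-dimensional linear subspace $w$ of $\mathbb{F}_q^n$ there is a $k$-plane $w'$ with direction $w$ such that $w' \subset E$. Here $k = n-1$. $|E|$ denotes the cardinality of $E$. The inequality is between rational (real) numbers. *)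

theory Defs
  imports "HOL-Analysis.Cartesian_Space"
begin

definition kakeya_wrt_planes :: "nat \<Rightarrow> ('a::field ^ 'n) set \<Rightarrow> bool" where
  "kakeya_wrt_planes k E \<longleftrightarrow>
     (\<forall>w. vec.subspace w \<and> vec.dim w = k \<longrightarrow> (\<exists>v. (+) v ` w \<subseteq> E))"

abbreviation kakeya_wrt_hyperplanes :: "('a::field ^ 'n) set \<Rightarrow> bool" where
  "kakeya_wrt_hyperplanes (E :: ('a ^ 'n) set) \<equiv> kakeya_wrt_planes (CARD('n) - 1) E"

end

theory Submission
  imports Defs "HOL-Analysis.Convex"
begin

text \<open>
  The bound is a second moment estimate for the number of chosen hyperplanes through a point.
  Index hyperplane directions by nonzero normal vectors \<open>a\<close> with respect to the
  coordinatewise scalar product. Every direction is then counted \<open>q - 1\<close> times, once for every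
  nonzero multiple of \<open>a\<close>, which spares counting subspaces. For every \<open>a\<close> let \<open>H a\<close> be the hyperplane
  with normal \<open>a\<close> that the Kakeya property places inside \<open>E\<close>, chosen as a function of the
  direction alone, so that proportional normals receive the same hyperplane.

  Put \<open>N = q ^ n\<close>. Each \<open>H a\<close> has \<open>N / q\<close> points. For a fixed \<open>a\<close>, the \<open>q - 1\<close> nonzero
  multiples \<open>b\<close> of \<open>a\<close> give \<open>H a \<inter> H b = H a\<close>, while the remaining \<open>N - q\<close> nonzero vectors \<open>b\<close> are linearly
  independent of \<open>a\<close> and give \<open>N / q\<^sup>2\<close> common points (lemma \<open>card_two_level_sets\<close>). The
  Cauchy-Schwarz inequality (lemma \<open>incidence_second_moment\<close>) compares these counts:
  \<open>((N - 1) N / q)\<^sup>2 \<le> |E| (N - 1) ((q - 1) N / q + (N - q) N / q\<^sup>2)\<close>. Clearing the common factors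
  leaves \<open>(N - 1) N \<le> |E| (N + q\<^sup>2 - 2 q)\<close>, which is the claim.
\<close>

section \<open>The second moment method for incidences\<close>

text \<open>
  Both sums count incidences weighted by the degree \<open>f x\<close> of a point, the number of sets \<open>H a\<close>
  through \<open>x\<close>: the sum of the sizes is the sum of \<open>f\<close>, and the sum over the pairwise intersections
  is the sum of \<open>f\<^sup>2\<close>. As \<open>f\<close> is supported on \<open>E\<close>, this is the Cauchy-Schwarz inequality for \<open>f\<close>
  and the constant function \<open>1\<close> on \<open>E\<close>.
\<close>

lemma incidence_second_moment:
  fixes H :: "'i \<Rightarrow> 'p set"
  assumes "finite A" "finite E" and sub: "\<And>a. a \<in> A \<Longrightarrow> H a \<subseteq> E"
  shows "(\<Sum>a\<in>A. real (card (H a)))\<^sup>2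
           \<le> real (card E) * (\<Sum>a\<in>A. \<Sum>b\<in>A. real (card (H a \<inter> H b)))"
proof -
  define ind :: "'i \<Rightarrow> 'p \<Rightarrow> real" where "ind a x = of_bool (x \<in> H a)" for a x
  define f where "f x = (\<Sum>a\<in>A. ind a x)" for x
  have "real (card (H a)) = (\<Sum>x\<in>E. ind a x)" if "a \<in> A" for a
  proof -
    have "{x \<in> E. x \<in> H a} = H a" using sub[OF that] by auto
    then show ?thesis
      using \<open>finite E\<close> by (simp add: ind_def of_bool_def sum.If_cases Int_def)
  qed
  then have first: "(\<Sum>a\<in>A. real (card (H a))) = (\<Sum>x\<in>E. f x)"
    unfolding f_def by (subst sum.swap) simp
  have "real (card (H a \<inter> H b)) = (\<Sum>x\<in>E. ind a x * ind b x)" if "a \<in> A" for a b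
  proof -
    have "{x \<in> E. x \<in> H a \<and> x \<in> H b} = H a \<inter> H b" using sub[OF that] by auto
    moreover have "ind a x * ind b x = of_bool (x \<in> H a \<and> x \<in> H b)" for x
      by (simp add: ind_def)
    ultimately show ?thesis
      using \<open>finite E\<close> by (simp add: of_bool_def sum.If_cases Int_def)
  qed
  then have "(\<Sum>a\<in>A. \<Sum>b\<in>A. real (card (H a \<inter> H b)))
      = (\<Sum>a\<in>A. \<Sum>b\<in>A. \<Sum>x\<in>E. ind a x * ind b x)"
    by simp
  also have "\<dots> = (\<Sum>a\<in>A. \<Sum>x\<in>E. \<Sum>b\<in>A. ind a x * ind b x)"
    by (intro sum.cong refl sum.swap)
  also have "\<dots> = (\<Sum>x\<in>E. \<Sum>a\<in>A. \<Sum>b\<in>A. ind a x * ind b x)"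
    by (rule sum.swap)
  also have "\<dots> = (\<Sum>x\<in>E. (f x)\<^sup>2)"
    by (simp add: f_def power2_eq_square sum_product)
  finally have second: "(\<Sum>a\<in>A. \<Sum>b\<in>A. real (card (H a \<inter> H b))) = (\<Sum>x\<in>E. (f x)\<^sup>2)" .
  show ?thesis
    using sum_squared_le_sum_of_squares[of f E] by (simp add: first second mult.commute)
qed

section \<open>Level sets of linear forms over a finite field\<close>

text \<open>
  Fibres of a surjective homomorphism are translates of each other, hence equinumerous.
\<close>

lemma card_fibre_additive:
  fixes f :: "'g::{finite,ab_group_add} \<Rightarrow> 'h::{finite,ab_group_add}"
  assumes add: "\<And>x y. f (x + y) = f x + f y" and "surj f"
  shows "CARD('h) * card {x. f x = c} = CARD('g)"
proof -
  have fibre: "card {x. f x = d} = card {x. f x = c}" for d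
  proof -
    obtain z where z: "f z = d - c" using \<open>surj f\<close> by (metis surjD)
    have "{x. f x = d} = (+) z ` {x. f x = c}"
    proof (intro set_eqI iffI)
      fix x assume "x \<in> {x. f x = d}"
      then have "f (x - z) = c" using add[of z "x - z"] z by (simp add: algebra_simps)
      then show "x \<in> (+) z ` {x. f x = c}" by (intro image_eqI[of _ _ "x - z"]) auto
    qed (auto simp: add z)
    then show ?thesis by (simp add: card_image)
  qed
  have "CARD('g) = card (\<Union>d. {x. f x = d})" by (rule arg_cong[of _ _ card]) auto
  also have "\<dots> = (\<Sum>d\<in>UNIV. card {x. f x = d})"
    by (intro card_UN_disjoint) auto
  also have "\<dots> = (\<Sum>d\<in>(UNIV :: 'h set). card {x. f x = c})"
    by (intro sum.cong refl fibre)
  finally show ?thesis by simp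
qed

lemma scalar_product_add: "scalar_product a (x + y) = scalar_product a x + scalar_product a y"
  by (simp add: scalar_product_def sum.distrib algebra_simps)

lemma scalar_product_scale_right:
  fixes a x :: "'a::comm_semiring_1 ^ 'n"
  shows "scalar_product a (c *s x) = c * scalar_product a x"
  by (simp add: scalar_product_def sum_distrib_left mult_ac)

lemma scalar_product_scale_left: "scalar_product (c *s a) x = c * scalar_product a x"
  by (simp add: scalar_product_def sum_distrib_left mult_ac)

lemma scalar_product_diff:
  fixes a x y :: "'a::ring_1 ^ 'n"
  shows "scalar_product a (x - y) = scalar_product a x - scalar_product a y"
  by (simp add: scalar_product_def sum_subtractf algebra_simps)

lemma scalar_product_axis: "scalar_product a (axis i c) = a $ i * c"
proof -
  have "(\<Sum>j\<in>UNIV. a $ j * axis i c $ j) = (\<Sum>j\<in>UNIV. if j = i then a $ i * c else 0)"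
    by (intro sum.cong) (auto simp: axis_def)
  then show ?thesis by (simp add: scalar_product_def)
qed

lemma surj_scalar_product:
  fixes a :: "'a::field ^ 'n"
  assumes "a \<noteq> 0"
  shows "surj (scalar_product a)"
proof -
  obtain i where "a $ i \<noteq> 0" using assms by (auto simp: vec_eq_iff)
  then have "scalar_product a (axis i (c / a $ i)) = c" for c
    by (simp add: scalar_product_axis)
  then show ?thesis by (rule surjI)
qed

text \<open>
  If \<open>b\<close> is not a multiple of \<open>a\<close>, some \<open>2 \<times> 2\<close> minor of the matrix with rows \<open>a\<close> and \<open>b\<close> does not
  vanish, and Cramer's rule on the two columns of that minor solves the system.
\<close>

lemma surj_scalar_product_pair:
  fixes a b :: "'a::field ^ 'n"
  assumes "a \<noteq> 0" and indep: "\<And>t. b \<noteq> t *s a"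
  shows "surj (\<lambda>x. (scalar_product a x, scalar_product b x))"
proof -
  obtain i where i: "a $ i \<noteq> 0" using \<open>a \<noteq> 0\<close> by (auto simp: vec_eq_iff)
  obtain j where j: "a $ i * b $ j - a $ j * b $ i \<noteq> 0"
  proof -
    obtain j where "b $ j \<noteq> (b $ i / a $ i) * a $ j"
      using indep[of "b $ i / a $ i"] by (auto simp: vec_eq_iff)
    then have "a $ i * b $ j - a $ j * b $ i \<noteq> 0" using i by (auto simp: field_simps)
    then show ?thesis by (rule that)
  qed
  define D where "D = a $ i * b $ j - a $ j * b $ i"
  have "\<exists>x. scalar_product a x = c \<and> scalar_product b x = d" for c d
  proof -
    define x where "x = axis i ((c * b $ j - a $ j * d) / D) + axis j ((a $ i * d - c * b $ i) / D)"
    have "D \<noteq> 0" using j by (simp add: D_def)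
    have "scalar_product a x = c * D / D" "scalar_product b x = d * D / D"
      unfolding x_def scalar_product_add scalar_product_axis times_divide_eq_right
        add_divide_distrib[symmetric]
      by (rule arg_cong[of _ _ "\<lambda>y. y / D"], simp add: D_def algebra_simps)+
    then show ?thesis using \<open>D \<noteq> 0\<close> by auto
  qed
  then show ?thesis by (simp add: surj_def) metis
qed

lemma card_level_set:
  fixes a :: "'a::{field,finite} ^ 'n"
  assumes "a \<noteq> 0"
  shows "CARD('a) * card {x. scalar_product a x = c} = CARD('a ^ 'n)"
  by (rule card_fibre_additive[OF scalar_product_add surj_scalar_product[OF assms]])

lemma card_two_level_sets:
  fixes a b :: "'a::{field,finite} ^ 'n"
  assumes "a \<noteq> 0" and "\<And>t. b \<noteq> t *s a"
  shows "CARD('a)\<^sup>2 * card ({x. scalar_product a x = c} \<inter> {x. scalar_product b x = d}) = CARD('a ^ 'n)"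
proof -
  have "CARD('a \<times> 'a) * card {x. (scalar_product a x, scalar_product b x) = (c, d)} = CARD('a ^ 'n)"
    by (rule card_fibre_additive[OF _ surj_scalar_product_pair[OF assms]]) (simp add: scalar_product_add)
  then show ?thesis by (simp add: power2_eq_square Collect_conj_eq)
qed

section \<open>Hyperplanes through the origin\<close>

lemma subspace_scalar_product_kernel: "vec.subspace {x. scalar_product a x = 0}"
  by (auto simp: vec.subspace_def scalar_product_add scalar_product_scale_right) (simp add: scalar_product_def)

text \<open>
  If \<open>e\<close> has scalar product \<open>1\<close> with \<open>a\<close>, then subtracting from \<open>x\<close> the multiple of \<open>e\<close> by the
  scalar product of \<open>a\<close> and \<open>x\<close> leaves a vector of the kernel. So the kernel and \<open>e\<close> together span
  the whole space, and the kernel falls short of it by one dimension.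
\<close>

lemma dim_scalar_product_kernel:
  fixes a :: "'a::field ^ 'n"
  assumes "a \<noteq> 0"
  shows "vec.dim {x. scalar_product a x = 0} = CARD('n) - 1"
proof -
  let ?K = "{x. scalar_product a x = 0}"
  have spanK: "vec.span ?K = ?K" using subspace_scalar_product_kernel by (simp add: vec.span_eq_iff)
  obtain e where e: "scalar_product a e = 1" using surj_scalar_product[OF assms] by (metis surjD)
  have "x \<in> vec.span (insert e ?K)" for x
    using e unfolding vec.span_insert spanK
    by (auto intro!: exI[of _ "scalar_product a x"] simp: scalar_product_diff scalar_product_scale_right)
  then have "vec.dim (insert e ?K) = CARD('n)"
    by (metis UNIV_eq_I vec.dim_span vec.dim_UNIV vec_dim_card)
  moreover have "vec.dim (insert e ?K) = vec.dim ?K + 1"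
    using e by (subst vec.dim_insert) (simp add: spanK)
  ultimately show ?thesis by simp
qed

text \<open>
  The hyperplanes given by the Kakeya property, described by equations. The translation vector is
  chosen for the direction; proportional normals define the same direction, and this is why they
  obtain proportional right-hand sides, that is, the same hyperplane.
\<close>

lemma kakeya_hyperplane_equations:
  fixes E :: "('a::field ^ 'n) set"
  assumes "kakeya_wrt_hyperplanes E"
  obtains c where "\<And>a. a \<noteq> 0 \<Longrightarrow> {x. scalar_product a x = c a} \<subseteq> E"
    and "\<And>a t. t \<noteq> 0 \<Longrightarrow> c (t *s a) = t * c a"
proof -
  obtain V where V: "\<And>w. vec.subspace w \<Longrightarrow> vec.dim w = CARD('n) - 1 \<Longrightarrow> (+) (V w) ` w \<subseteq> E"
    using assms unfolding kakeya_wrt_planes_def by metis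
  define K where "K a = {x. scalar_product a x = 0}" for a :: "'a ^ 'n"
  define c where "c a = scalar_product a (V (K a))" for a
  show thesis
  proof
    show "{x. scalar_product a x = c a} \<subseteq> E" if "a \<noteq> 0" for a
    proof
      fix x assume "x \<in> {x. scalar_product a x = c a}"
      then have "x - V (K a) \<in> K a" by (simp add: K_def c_def scalar_product_diff)
      then have "x \<in> (+) (V (K a)) ` K a" by (intro image_eqI[of _ _ "x - V (K a)"]) auto
      moreover have "(+) (V (K a)) ` K a \<subseteq> E"
        using V[OF subspace_scalar_product_kernel dim_scalar_product_kernel[OF that]] by (simp add: K_def)
      ultimately show "x \<in> E" by auto
    qed
    show "c (t *s a) = t * c a" if "t \<noteq> 0" for a t
      using that by (simp add: c_def K_def scalar_product_scale_left)
  qed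
qed

section \<open>The Kakeya bound\<close>

text \<open>
  For a fixed normal, the second moment splits into its \<open>q - 1\<close> nonzero multiples and the \<open>N - q\<close>
  vectors independent of it. The factor \<open>q\<^sup>2\<close> on the left keeps the count free of \<open>q ^ (n - 2)\<close>,
  so that \<open>n = 1\<close>, where no independent vectors exist, is included.
\<close>

lemma sum_card_Int_level_sets:
  fixes a :: "'a::{field,finite} ^ 'n" and q N :: real
  assumes "a \<noteq> 0" and homogeneous: "\<And>b t. t \<noteq> 0 \<Longrightarrow> c (t *s b) = t * c b"
  defines "H b \<equiv> {x. scalar_product b x = c b}"
  defines "q \<equiv> real CARD('a)" and "N \<equiv> real CARD('a ^ 'n)"
  shows "q\<^sup>2 * (\<Sum>b\<in>-{0}. real (card (H a \<inter> H b))) = N * (N + q\<^sup>2 - 2 * q)"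
proof -
  define P where "P = (\<lambda>t. t *s a) ` (-{0})"
  have q1: "CARD('a) \<ge> 1" by (simp add: Suc_leI)
  have "inj_on (\<lambda>t. t *s a) (-{0})" using \<open>a \<noteq> 0\<close> by (auto intro!: inj_onI)
  then have cardP: "card P = CARD('a) - 1"
    by (simp add: P_def card_image Compl_eq_Diff_UNIV card_Diff_singleton)
  have P_sub: "P \<subseteq> -{0}" using \<open>a \<noteq> 0\<close> by (auto simp: P_def)
  have "card (-{0} - P) = CARD('a ^ 'n) - 1 - (CARD('a) - 1)"
    using P_sub cardP
    by (simp add: card_Diff_subset Compl_eq_Diff_UNIV card_Diff_singleton)
  moreover have "CARD('a) - 1 \<le> CARD('a ^ 'n) - 1"
    using card_mono[OF _ P_sub] cardP by (simp add: Compl_eq_Diff_UNIV card_Diff_singleton)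
  moreover have "CARD('a ^ 'n) \<ge> 1" by (simp add: Suc_leI)
  ultimately have cardQ: "real (card (-{0} - P)) = N - q"
    using q1 unfolding N_def q_def by linarith
  have parallel: "q\<^sup>2 * real (card (H a \<inter> H b)) = q * N" if "b \<in> P" for b
  proof -
    have "H b = H a"
      using that by (auto simp: P_def H_def homogeneous scalar_product_scale_left)
    moreover have "q * real (card (H a)) = N"
      using card_level_set[OF \<open>a \<noteq> 0\<close>, of "c a"]
      unfolding H_def q_def N_def by (metis of_nat_mult)
    ultimately show ?thesis by (simp add: power2_eq_square)
  qed
  have transversal: "q\<^sup>2 * real (card (H a \<inter> H b)) = N" if "b \<in> -{0} - P" for b
  proof -
    have "b \<noteq> t *s a" for t using that by (cases "t = 0") (auto simp: P_def)
    then show ?thesis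
      using card_two_level_sets[OF \<open>a \<noteq> 0\<close>, of b "c a" "c b"]
      by (simp add: H_def q_def N_def flip: of_nat_mult of_nat_power)
  qed
  have "q\<^sup>2 * (\<Sum>b\<in>-{0}. real (card (H a \<inter> H b)))
      = (\<Sum>b\<in>-{0} - P. q\<^sup>2 * real (card (H a \<inter> H b))) + (\<Sum>b\<in>P. q\<^sup>2 * real (card (H a \<inter> H b)))"
    unfolding sum_distrib_left by (rule sum.subset_diff) (use P_sub in auto)
  also have "\<dots> = (N - q) * N + (q - 1) * (q * N)"
    using parallel transversal cardQ cardP q1 by (simp add: q_def of_nat_diff)
  finally show ?thesis by (simp add: algebra_simps power2_eq_square)
qed

theorem theorem1:
  fixes E :: "('a::{field,finite} ^ 'n) set"
    and q n :: nat
  assumes "CARD('a) = q"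
    and "CARD('n) = n"
    and "kakeya_wrt_hyperplanes E"
  shows "real (card E) \<ge> (real q ^ (2 * n) - real q ^ n) / (real q ^ n + real q ^ 2 - 2 * real q)"
proof -
  obtain c where sub: "\<And>a. a \<noteq> 0 \<Longrightarrow> {x. scalar_product a x = c a} \<subseteq> E"
    and homogeneous: "\<And>a t. t \<noteq> 0 \<Longrightarrow> c (t *s a) = t * c a"
    using kakeya_hyperplane_equations[OF assms(3)] by blast
  define H where "H a = {x. scalar_product a x = c a}" for a
  define Q N where "Q = real q" and "N = real q ^ n"
  define D where "D = N + Q\<^sup>2 - 2 * Q"
  have N: "real CARD('a ^ 'n) = N" using assms(1,2) by (simp add: N_def)
  have "card {0, 1 :: 'a} \<le> CARD('a)" by (intro card_mono) auto
  then have Q2: "Q \<ge> 2" using assms(1) by (simp add: Q_def)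
  have "n \<ge> 1" using assms(2) by (auto simp: Suc_leI)
  then have "N > 1" using Q2 unfolding N_def Q_def by (intro one_less_power) auto
  then have D: "D > 0"
    using Q2 mult_right_mono[of 2 Q Q] unfolding D_def power2_eq_square by linarith
  have card_normals: "real (card (-{0} :: ('a ^ 'n) set)) = N - 1"
    using N \<open>N > 1\<close> by (simp add: Compl_eq_Diff_UNIV card_Diff_singleton of_nat_diff)
  have "Q * real (card (H a)) = N" if "a \<noteq> 0" for a
    using card_level_set[OF that, of "c a"] N assms(1)
    by (simp add: H_def Q_def flip: of_nat_mult)
  then have "Q * (\<Sum>a\<in>-{0}. real (card (H a))) = (N - 1) * N"
    using card_normals by (simp add: sum_distrib_left)
  then have first: "Q\<^sup>2 * (\<Sum>a\<in>-{0}. real (card (H a)))\<^sup>2 = ((N - 1) * N)\<^sup>2"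
    by (metis power_mult_distrib)
  have "Q\<^sup>2 * (\<Sum>b\<in>-{0}. real (card (H a \<inter> H b))) = N * D" if "a \<noteq> 0" for a
    using sum_card_Int_level_sets[OF that homogeneous] N assms(1)
    by (simp add: H_def Q_def D_def)
  then have second: "Q\<^sup>2 * (\<Sum>a\<in>-{0}. \<Sum>b\<in>-{0}. real (card (H a \<inter> H b))) = (N - 1) * (N * D)"
    using card_normals by (simp add: sum_distrib_left[of "Q\<^sup>2" _ "-{0}"])
  have "(\<Sum>a\<in>-{0}. real (card (H a)))\<^sup>2
      \<le> real (card E) * (\<Sum>a\<in>-{0}. \<Sum>b\<in>-{0}. real (card (H a \<inter> H b)))"
    by (rule incidence_second_moment) (use sub in \<open>auto simp: H_def\<close>)
  from mult_left_mono[OF this, of "Q\<^sup>2"]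
  have "((N - 1) * N)\<^sup>2 \<le> real (card E) * ((N - 1) * (N * D))"
    using first second by (simp add: mult.left_commute)
  then have "((N - 1) * N) * ((N - 1) * N) \<le> ((N - 1) * N) * (real (card E) * D)"
    by (simp add: power2_eq_square mult_ac)
  then have "(N - 1) * N \<le> real (card E) * D"
    using \<open>N > 1\<close> by (subst (asm) mult_le_cancel_left_pos) auto
  then have "(N - 1) * N / D \<le> real (card E)"
    using D by (simp add: pos_divide_le_eq)
  moreover have "(N - 1) * N = real q ^ (2 * n) - real q ^ n"
    by (simp add: N_def left_diff_distrib mult_2 power_add)
  ultimately show ?thesis by (simp add: D_def N_def Q_def)
qed

end
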